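(* Let $S\in\mathbb{C}^{n\times n}$ be a nonsingular matrix with $\lambda(S)\subset\mathbb{C}^+$, let $\gamma>0$, let $r>1$ be an integer, and let $\{\widehat{Q}_k\}_{k\ge1}$ be the sequence generated from $\widehat{Q}_1=\gamma I_n$ by the order-$r$ square root iteration described in the context. Let $\|\cdot\|$ be an induced matrix norm such that $\|\mathcal{C}_{\sqrt{S}}(\widehat{Q}_1)\|<1$. Then there is a constant $\mu>0$ such that for all $k\ge 1$ $$\|\widehat{Q}_{k+1}-\sqrt{S}\|\le\mu\,\|\widehat{Q}_k-\sqrt{S}\|^r ;$$ that is, $\widehat{Q}_k\to\sqrt{S}$ with q-order $r$.
   Context: $\mathbb{C}^+$ is the open right half plane and $\lambda(S)$ the set of eigenvalues of $S$. $\sqrt{S}$ is the principal square root of $S$: the unique matrix $X$ with $X^2=S$ and $\lambda(X)\subset\mathbb{C}^+$. For a matrix $X$ with $X+\sqrt{S}$ nonsingular, $\mathcal{C}_{\sqrt{S}}(X)=(X-\sqrt{S})(X+\sqrt{S})^{-1}$. Order-$r$ square root iteration (stopping criteria ignored): $\widehat{Q}_1=\gamma I_n$; for $k\ge 2$ put $Q_{k-1}^{(1)}=\widehat{Q}_{k-1}$, for $\ell=1,\dots,r-2$ put $$Q_{k-1}^{(\ell+1)}=(S+\widehat{Q}_{k-1}Q_{k-1}^{(\ell)})(\widehat{Q}_{k-1}+Q_{k-1}^{(\ell)})^{-1},$$ and finally $$\widehat{Q}_k=(S+\widehat{Q}_{k-1}Q_{k-1}^{(r-1)})(\widehat{Q}_{k-1}+Q_{k-1}^{(r-1)})^{-1}.$$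 A sequence $X_k$ converges to $X$ with q-order $r>1$ if $X_k\to X$ and there is $K>0$ with $\|X_{k+1}-X\|\le K\|X_k-X\|^r$. *)

theory Defs
  imports "HOL-Analysis.Analysis"
begin

definition eigenvalues :: "complex ^ 'n ^ 'n \<Rightarrow> complex set" where
  "eigenvalues A = {z. \<exists>v. v \<noteq> 0 \<and> A *v v = z *s v}"

definition right_half_plane :: "complex set" where
  "right_half_plane = {z. 0 < Re z}"

definition is_principal_sqrt :: "complex ^ 'n ^ 'n \<Rightarrow> complex ^ 'n ^ 'n \<Rightarrow> bool" where
  "is_principal_sqrt S X \<longleftrightarrow> X ** X = S \<and> eigenvalues X \<subseteq> right_half_plane"

(* The definite description denotes the intended matrix only where existence and uniqueness
   hold, e.g. when all eigenvalues of S lie in the open right half plane. *)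
definition principal_sqrt :: "complex ^ 'n ^ 'n \<Rightarrow> complex ^ 'n ^ 'n" where
  "principal_sqrt S = (THE X. is_principal_sqrt S X)"

(* matrix_inv is total; its value is meaningful only when X + R is invertible. *)
definition cayley :: "complex ^ 'n ^ 'n \<Rightarrow> complex ^ 'n ^ 'n \<Rightarrow> complex ^ 'n ^ 'n" where
  "cayley R X = (X - R) ** matrix_inv (X + R)"

definition is_vector_norm :: "(complex ^ 'n \<Rightarrow> real) \<Rightarrow> bool" where
  "is_vector_norm N \<longleftrightarrow>
     (\<forall>x. 0 \<le> N x) \<and> (\<forall>x. N x = 0 \<longleftrightarrow> x = 0) \<and>
     (\<forall>c x. N (c *s x) = cmod c * N x) \<and> (\<forall>x y. N (x + y) \<le> N x + N y)"

definition induced_norm :: "(complex ^ 'n \<Rightarrow> real) \<Rightarrow> complex ^ 'n ^ 'n \<Rightarrow> real" where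
  "induced_norm N A = (SUP x \<in> {x. x \<noteq> 0}. N (A *v x) / N x)"

definition is_induced_matrix_norm :: "(complex ^ 'n ^ 'n \<Rightarrow> real) \<Rightarrow> bool" where
  "is_induced_matrix_norm M \<longleftrightarrow> (\<exists>N. is_vector_norm N \<and> M = induced_norm N)"

(* Q k is the k-th outer iterate (k \<ge> 1), and Y k l the inner iterate Q_k^(l) for 1 \<le> l \<le> r - 1.
   Values at other indices are unconstrained. *)
definition order_sqrt_iteration ::
  "complex ^ 'n ^ 'n \<Rightarrow> real \<Rightarrow> nat \<Rightarrow> (nat \<Rightarrow> complex ^ 'n ^ 'n) \<Rightarrow> bool" where
  "order_sqrt_iteration S \<gamma> r Q \<longleftrightarrow>
     Q 1 = mat (complex_of_real \<gamma>) \<and>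
     (\<exists>Y :: nat \<Rightarrow> nat \<Rightarrow> complex ^ 'n ^ 'n. \<forall>k\<ge>2.
        Y (k - 1) 1 = Q (k - 1) \<and>
        (\<forall>l\<in>{1..r - 2}.
           Y (k - 1) (l + 1) =
             (S + Q (k - 1) ** Y (k - 1) l) ** matrix_inv (Q (k - 1) + Y (k - 1) l)) \<and>
        Q k = (S + Q (k - 1) ** Y (k - 1) (r - 1)) ** matrix_inv (Q (k - 1) + Y (k - 1) (r - 1)))"

(* Sequences are indexed from 1. *)
definition converges_with_q_order ::
  "(complex ^ 'n ^ 'n \<Rightarrow> real) \<Rightarrow> nat \<Rightarrow> (nat \<Rightarrow> complex ^ 'n ^ 'n) \<Rightarrow> complex ^ 'n ^ 'n \<Rightarrow> bool" where
  "converges_with_q_order M r X L \<longleftrightarrow>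
     1 < r \<and> X \<longlonglongrightarrow> L \<and> (\<exists>K>0. \<forall>k\<ge>1. M (X (k + 1) - L) \<le> K * M (X k - L) ^ r)"

end

(* With R the principal square root of S, the substitution X = (I + E)(I - E)^{-1} R, where
   E = (X - R)(X + R)^{-1}, turns the map (X, Y) |-> (S + X Y)(X + Y)^{-1} into multiplication of the
   Cayley transforms.  Hence every inner and outer iterate is the inverse transform of a power of
   the Cayley transform C of the initial value, an outer step raises that power to the r-th power,
   and all the required inverses exist because the norm of C is below one.  The order of
   convergence follows by comparing X - R with E: the factors relating them stay bounded. *)

theory Submission
  imports Defs "HOL-Computational_Algebra.Fundamental_Theorem_Algebra"
begin

text \<open>\<open>principal_sqrt\<close> is a definite description, so existence and uniqueness
  must be established before anything can be said about the limit. Both come from polynomials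
  evaluated at a matrix instead of a Jordan form: an annihilating polynomial of least degree has
  exactly the eigenvalues as its roots. In the iteration the obstacle is noncommutativity.
  Denominators are cleared by right multiplication with polynomials in \<open>C\<close>, which
  commute with each other and with \<open>R\<close>, so each matrix identity reduces to one between
  scalar polynomials. The order constant can be chosen independently of \<open>k\<close> because
  every power \<open>i >= 1\<close> of \<open>C\<close> has norm at most \<open>M C < 1\<close>: the
  single number \<open>1 / (1 - M C)\<close> bounds the inverses of all the denominators
  \<open>1 - C^i\<close>.\<close>

section \<open>Elementary algebra of matrices, scalar matrices and inverses\<close>

lemma matrix_mul_rdistrib: "(A + B) ** C = A ** C + B ** (C :: 'a::semiring_1 ^ 'n ^ 'm)"
  by (vector matrix_matrix_mult_def sum.distrib[symmetric] field_simps)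

lemma matrix_mul_diff_rdistrib: "(A - B) ** C = A ** C - B ** (C :: 'a::ring_1 ^ 'n ^ 'm)"
  by (vector matrix_matrix_mult_def sum_subtractf[symmetric] left_diff_distrib)

lemma matrix_mul_diff_ldistrib: "(C :: 'a::ring_1 ^ 'n ^ 'm) ** (A - B) = C ** A - C ** B"
  by (vector matrix_matrix_mult_def sum_subtractf[symmetric] right_diff_distrib)

lemma mat_mul_component: "(mat c ** A) $ i $ j = c * A $ i $ j"
  for A :: "'a::comm_ring_1 ^ 'm ^ 'n"
  by (simp add: matrix_matrix_mult_def mat_def if_distribR if_distrib[of "\<lambda>x. x * _"] cong: if_cong)

lemma mul_mat_component: "(A ** mat c) $ i $ j = A $ i $ j * c"
  for A :: "'a::comm_ring_1 ^ 'm ^ 'n"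
  by (simp add: matrix_matrix_mult_def mat_def if_distribR if_distrib[of "\<lambda>x. _ * x"] cong: if_cong)


lemma mat_vector_mul: "mat c *v v = c *s (v :: 'a::comm_ring_1 ^ 'n)"
  by (simp add: vec_eq_iff matrix_vector_mult_def mat_def if_distribR if_distrib[of "\<lambda>x. x * _"] cong: if_cong)

lemma mat_mul_commute: "mat c ** A = A ** mat c" for A :: "'a::comm_ring_1 ^ 'n ^ 'n"
  by (simp add: vec_eq_iff mat_mul_component mul_mat_component mult.commute)

lemma mat_mul_mat: "mat a ** mat b = (mat (a * b) :: 'a::comm_ring_1 ^ 'n ^ 'n)"
  by (simp add: vec_eq_iff mat_mul_component) (simp add: mat_def)


lemma mat_add: "mat (a + b) = mat a + (mat b :: 'a::comm_ring_1 ^ 'n ^ 'n)"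
  by (vector mat_def)

lemma matrix_inv_mul:
  assumes "invertible A"
  shows "A ** matrix_inv A = mat 1" "matrix_inv A ** A = mat 1"
  using someI_ex[OF assms[unfolded invertible_def]] by (auto simp: matrix_inv_def)

lemma matrix_inv_commute:
  fixes A B :: "'a::semiring_1 ^ 'n ^ 'n"
  assumes "invertible A" "A ** B = B ** A"
  shows "matrix_inv A ** B = B ** matrix_inv A"
  by (metis assms matrix_inv_mul matrix_mul_assoc matrix_mul_lid matrix_mul_rid)

lemma invertible_matrix_mul_cancel_right:
  fixes A B C :: "'a::semiring_1 ^ 'n ^ 'n"
  assumes "invertible C" "A ** C = B ** C"
  shows "A = B"
  by (metis assms matrix_inv_mul(1) matrix_mul_assoc matrix_mul_rid)

lemma matrix_eq_mul_inv:
  fixes A B C :: "'a::semiring_1 ^ 'n ^ 'n"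
  assumes "invertible C" "A ** C = B"
  shows "A = B ** matrix_inv C"
  by (metis assms matrix_inv_mul(1) matrix_mul_assoc matrix_mul_rid)

lemma invertible_if_ker_trivial:
  fixes A :: "'a::field ^ 'n ^ 'n"
  assumes "\<And>v. A *v v = 0 \<Longrightarrow> v = 0"
  shows "invertible A"
  using assms by (auto simp: invertible_left_inverse matrix_left_invertible_ker)

lemma invertible_if_mul_invertible:
  fixes A B :: "'a::field ^ 'n ^ 'n"
  assumes "invertible (A ** B)"
  shows "invertible A"
  using assms by (metis invertible_right_inverse matrix_mul_assoc matrix_inv_mul(1))

subsection \<open>Polynomials evaluated at matrices\<close>

definition matrix_poly :: "complex ^ 'n ^ 'n \<Rightarrow> complex poly \<Rightarrow> complex ^ 'n ^ 'n" where
  "matrix_poly A p = fold_coeffs (\<lambda>a B. mat a + A ** B) p 0"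

lemma matrix_poly_0 [simp]: "matrix_poly A 0 = 0"
  by (simp add: matrix_poly_def)

lemma matrix_poly_pCons [simp]: "matrix_poly A (pCons a p) = mat a + A ** matrix_poly A p"
  by (cases "p = 0 \<and> a = 0") (auto simp: matrix_poly_def)

lemma matrix_poly_1 [simp]: "matrix_poly A 1 = mat 1"
  by (simp add: one_pCons)

lemma matrix_poly_add: "matrix_poly A (p + q) = matrix_poly A p + matrix_poly A q"
  by (induction p q rule: poly_induct2)
    (simp_all add: matrix_add_ldistrib mat_add algebra_simps)

lemma matrix_poly_smult: "matrix_poly A (smult c p) = mat c ** matrix_poly A p"
proof (induction p)
  case (pCons a p)
  have "matrix_poly A (smult c (pCons a p)) = mat (c * a) + A ** (mat c ** matrix_poly A p)"
    using pCons.IH by (simp only: smult_pCons matrix_poly_pCons)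
  also have "\<dots> = mat c ** mat a + mat c ** (A ** matrix_poly A p)"
    unfolding matrix_mul_assoc mat_mul_commute[of c A] mat_mul_mat ..
  finally show ?case
    by (simp only: matrix_poly_pCons matrix_add_ldistrib)
qed simp

lemma matrix_poly_uminus: "matrix_poly A (- p) = - matrix_poly A p"
  using matrix_poly_add[of A p "- p"] by (simp add: eq_neg_iff_add_eq_0 add.commute)

lemma matrix_poly_diff: "matrix_poly A (p - q) = matrix_poly A p - matrix_poly A q"
  using matrix_poly_add[of A p "- q"] by (simp add: matrix_poly_uminus)

lemma matrix_poly_mult: "matrix_poly A (p * q) = matrix_poly A p ** matrix_poly A q"
  by (induction p)
    (simp_all add: matrix_poly_add matrix_poly_smult matrix_mul_rdistrib matrix_mul_assoc)

lemma matrix_poly_sum: "matrix_poly A (\<Sum>i\<in>I. f i) = (\<Sum>i\<in>I. matrix_poly A (f i))"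
  by (induction I rule: infinite_finite_induct) (simp_all add: matrix_poly_add)

lemma matrix_poly_commute: "matrix_poly A p ** matrix_poly A q = matrix_poly A q ** matrix_poly A p"
  unfolding matrix_poly_mult[symmetric] mult.commute[of p] ..

text \<open>Serves two ends: with \<open>A = B\<close> it lets \<open>R\<close> pass through
  polynomials in \<open>C\<close>, and with \<open>D\<close> the difference of two square roots it
  drives the uniqueness proof.\<close>

lemma matrix_poly_intertwine:
  fixes A B D :: "complex ^ 'n ^ 'n"
  assumes "B ** D = D ** A"
  shows "matrix_poly B p ** D = D ** matrix_poly A p"
proof (induction p)
  case (pCons a p)
  have "B ** matrix_poly B p ** D = B ** D ** matrix_poly A p"
    unfolding matrix_mul_assoc[symmetric] pCons.IH ..
  also have "\<dots> = D ** (A ** matrix_poly A p)"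
    unfolding assms matrix_mul_assoc ..
  finally show ?case
    unfolding matrix_poly_pCons matrix_mul_rdistrib matrix_add_ldistrib mat_mul_commute[of a D]
    by (rule arg_cong)
qed simp

lemma matrix_poly_eigenvector:
  assumes "A *v v = z *s v"
  shows "matrix_poly A p *v v = poly p z *s v"
proof (induction p)
  case (pCons a p)
  have "matrix_poly A (pCons a p) *v v = a *s v + A *v (poly p z *s v)"
    unfolding matrix_poly_pCons matrix_vector_mult_add_rdistrib mat_vector_mul
      matrix_vector_mul_assoc[symmetric] pCons.IH ..
  also have "\<dots> = (a + poly p z * z) *s v"
    unfolding vector_scalar_commute assms vector_smult_assoc vector_sadd_rdistrib ..
  finally show ?case
    by (simp add: mult.commute)
qed simp

lemma matrix_poly_linear_factor: "matrix_poly A ([:- z, 1:] * q) *v v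
    = A *v (matrix_poly A q *v v) - z *s (matrix_poly A q *v v)"
proof -
  have "matrix_poly A [:- z, 1:] *v w = A *v w - z *s w" for w
    by (simp add: matrix_vector_mult_add_rdistrib mat_vector_mul)
  then show ?thesis
    unfolding matrix_poly_mult matrix_vector_mul_assoc[symmetric] .
qed

section \<open>Annihilating polynomials and eigenvalues\<close>

text \<open>The powers of \<open>A\<close> live in a space of finite real dimension. Either two of
  them coincide, or one more than the dimension are distinct and hence linearly dependent; real
  coefficients suffice.\<close>

lemma ex_annihilating_poly:
  fixes A :: "complex ^ 'n ^ 'n"
  shows "\<exists>p. p \<noteq> 0 \<and> matrix_poly A p = 0"
proof -
  define f where "f i = matrix_poly A (monom 1 i)" for i
  show ?thesis
  proof (cases "inj f")
    case False
    then obtain i j where "i \<noteq> j" "f i = f j"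
      by (auto simp: inj_def)
    then show ?thesis
      by (intro exI[of _ "monom 1 i - monom 1 j"]) (simp add: matrix_poly_diff f_def monom_eq_iff')
  next
    case True
    define I where "I = {..DIM(complex ^ 'n ^ 'n)}"
    have "card (f ` I) = Suc (DIM(complex ^ 'n ^ 'n))"
      using True by (simp add: card_image inj_on_subset I_def)
    then have "dependent (f ` I)"
      using independent_bound[of "f ` I"] by fastforce
    then obtain u where u: "\<exists>v\<in>f ` I. u v \<noteq> (0::real)" "(\<Sum>v\<in>f ` I. u v *\<^sub>R v) = 0"
      by (auto simp: dependent_finite I_def)
    define p :: "complex poly" where "p = (\<Sum>i\<in>I. smult (of_real (u (f i))) (monom 1 i))"
    have scale: "mat (of_real c) ** B = c *\<^sub>R B" for c and B :: "complex ^ 'n ^ 'n"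
      by (simp add: vec_eq_iff mat_mul_component scaleR_conv_of_real[where 'a = complex])
    have "(\<Sum>i\<in>I. u (f i) *\<^sub>R f i) = 0"
      using u(2) True by (simp add: sum.reindex inj_on_subset)
    then have "matrix_poly A p = 0"
      by (simp add: p_def matrix_poly_sum matrix_poly_smult scale flip: f_def)
    moreover obtain i where i: "i \<in> I" "u (f i) \<noteq> 0"
      using u(1) by auto
    have "coeff p i = (\<Sum>j\<in>I. if j = i then of_real (u (f i)) else 0)"
      by (auto simp: p_def coeff_sum intro!: sum.cong)
    then have "coeff p i \<noteq> 0"
      using i by (simp add: I_def)
    ultimately show ?thesis
      by (metis coeff_0)
  qed
qed

text \<open>Split off a root \<open>z\<close> of \<open>p\<close> with quotient \<open>q\<close>. If
  \<open>q\<close> still kills \<open>w\<close>, descend; otherwise \<open>q(A) w\<close> is an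
  eigenvector for \<open>z\<close>. The descent cannot reach a constant, as a nonzero constant does
  not kill \<open>w\<close>.\<close>

lemma eigenvalue_if_poly_kills_vector:
  assumes "matrix_poly A p *v w = 0" "w \<noteq> 0" "p \<noteq> 0"
  shows "\<exists>z\<in>eigenvalues A. poly p z = 0"
  using assms
proof (induction "degree p" arbitrary: p rule: less_induct)
  case less
  show ?case
  proof (cases "degree p = 0")
    case True
    then obtain a where "p = [:a:]"
      by (rule degree_eq_zeroE)
    with less.prems show ?thesis
      by (simp add: mat_vector_mul)
  next
    case False
    then obtain z where z: "poly p z = 0"
      using fundamental_theorem_of_algebra[of p] by (auto simp: constant_degree)
    then obtain q where q: "p = [:- z, 1:] * q"
      by (auto simp: poly_eq_0_iff_dvd)
    with less.prems have "q \<noteq> 0"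
      by auto
    show ?thesis
    proof (cases "matrix_poly A q *v w = 0")
      case True
      moreover have "degree q < degree p"
        using q \<open>q \<noteq> 0\<close> by (simp add: degree_mult_eq del: mult_pCons_left)
      ultimately obtain z' where "z' \<in> eigenvalues A" "poly q z' = 0"
        using less.hyps less.prems(2) \<open>q \<noteq> 0\<close> by blast
      then show ?thesis
        using q by auto
    next
      case False
      have "A *v (matrix_poly A q *v w) = z *s (matrix_poly A q *v w)"
        using less.prems(1) unfolding q matrix_poly_linear_factor by simp
      with False z show ?thesis
        by (auto simp: eigenvalues_def)
    qed
  qed
qed

text \<open>Minimality of the degree makes every root an eigenvalue: dividing out a root leaves a
  polynomial that no longer annihilates \<open>A\<close>, and any nonzero value of it is an
  eigenvector.\<close>

lemma ex_minimal_poly: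
  obtains p where "p \<noteq> 0" "matrix_poly A p = 0" "{z. poly p z = 0} = eigenvalues A"
proof -
  define P where "P p \<longleftrightarrow> p \<noteq> 0 \<and> matrix_poly A p = 0" for p
  obtain p where p: "P p" and min: "\<And>q. P q \<Longrightarrow> degree p \<le> degree q"
    using ex_annihilating_poly[of A] ex_has_least_nat[of P _ degree] unfolding P_def by metis
  have "z \<in> eigenvalues A" if z: "poly p z = 0" for z
  proof -
    obtain q where q: "p = [:- z, 1:] * q"
      using z by (auto simp: poly_eq_0_iff_dvd)
    with p have "q \<noteq> 0"
      by (auto simp: P_def)
    then have "degree q < degree p"
      using q by (simp add: degree_mult_eq del: mult_pCons_left)
    then have "matrix_poly A q \<noteq> 0"
      using min[of q] \<open>q \<noteq> 0\<close> by (auto simp: P_def)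
    then obtain v where v: "matrix_poly A q *v v \<noteq> 0"
      by (metis matrix_eq matrix_vector_mult_0)
    have "matrix_poly A p *v v = 0"
      using p by (simp add: P_def)
    then have "A *v (matrix_poly A q *v v) = z *s (matrix_poly A q *v v)"
      unfolding q matrix_poly_linear_factor by simp
    with v show ?thesis
      by (auto simp: eigenvalues_def)
  qed
  moreover have "poly p z = 0" if z: "z \<in> eigenvalues A" for z
  proof -
    obtain v where "v \<noteq> 0" "A *v v = z *s v"
      using z by (auto simp: eigenvalues_def)
    then have "poly p z *s v = 0"
      using matrix_poly_eigenvector[of A v z p] p by (simp add: P_def)
    with \<open>v \<noteq> 0\<close> show ?thesis
      by simp
  qed
  ultimately show ?thesis
    using that[of p] p by (auto simp: P_def)
qed

subsection \<open>The principal square root\<close>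

text \<open>A Sylvester argument: \<open>X^2 = Y^2\<close> gives
  \<open>(-X) (X - Y) = (X - Y) Y\<close>. If \<open>X - Y\<close> were nonzero, the minimal
  polynomial of \<open>Y\<close> evaluated at \<open>-X\<close> would kill a nonzero vector, so
  \<open>-X\<close> and \<open>Y\<close> would share an eigenvalue, although their spectra lie in
  opposite half planes.\<close>

lemma is_principal_sqrt_unique:
  assumes "is_principal_sqrt S X" "is_principal_sqrt S Y"
  shows "X = Y"
proof (rule ccontr)
  assume "X \<noteq> Y"
  then have "X - Y \<noteq> 0"
    by simp
  then obtain w where w: "(X - Y) *v w \<noteq> 0"
    by (metis matrix_eq matrix_vector_mult_0)
  obtain p where p: "p \<noteq> 0" "matrix_poly Y p = 0" "{z. poly p z = 0} = eigenvalues Y"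
    by (rule ex_minimal_poly)
  have "X ** X = Y ** Y"
    using assms by (simp add: is_principal_sqrt_def)
  moreover have "(- X) ** (X - Y) = - (X ** (X - Y))"
    using matrix_mul_diff_rdistrib[of 0 X "X - Y"] by simp
  ultimately have "(- X) ** (X - Y) = (X - Y) ** Y"
    by (simp add: matrix_mul_diff_ldistrib matrix_mul_diff_rdistrib)
  then have "matrix_poly (- X) p ** (X - Y) = 0"
    using matrix_poly_intertwine p(2) by (metis times0_right)
  then have "matrix_poly (- X) p *v ((X - Y) *v w) = 0"
    by (simp add: matrix_vector_mul_assoc)
  then obtain z where z: "z \<in> eigenvalues (- X)" "poly p z = 0"
    using eigenvalue_if_poly_kills_vector w p(1) by blast
  then have "z \<in> eigenvalues Y"
    using p(3) by auto
  then have "Re z > 0"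
    using assms(2) unfolding is_principal_sqrt_def right_half_plane_def by blast
  obtain v where v: "v \<noteq> 0" "(- X) *v v = z *s v"
    using z(1) by (auto simp: eigenvalues_def)
  have "X *v v = - ((- X) *v v)"
    using matrix_vector_mult_diff_rdistrib[of 0 X v] by simp
  with v have "X *v v = (- z) *s v"
    by simp
  then have "- z \<in> eigenvalues X"
    using v by (auto simp: eigenvalues_def)
  then have "- z \<in> right_half_plane"
    using assms(1) unfolding is_principal_sqrt_def by blast
  with \<open>Re z > 0\<close> show False
    by (simp add: right_half_plane_def)
qed

text \<open>
  Hensel lifting: a factor \<^term>\<open>[:- z, 1:]\<close> is absorbed by adding a multiple of the previous
  modulus, chosen by Newton's formula if \<^term>\<open>z\<close> is already a root of it and to correct the value
  at \<^term>\<open>z\<close> otherwise.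
\<close>

lemma ex_poly_sqrt_mod:
  fixes p :: "complex poly"
  assumes "p \<noteq> 0" "poly p 0 \<noteq> 0"
  shows "\<exists>f. p dvd f\<^sup>2 - [:0, 1:] \<and> (\<forall>z. poly p z = 0 \<longrightarrow> poly f z = csqrt z)"
  using assms
proof (induction "degree p" arbitrary: p rule: less_induct)
  case less
  show ?case
  proof (cases "degree p = 0")
    case True
    then obtain a where a: "p = [:a:]"
      by (rule degree_eq_zeroE)
    with less.prems show ?thesis
      by (intro exI[of _ 0]) (simp add: const_poly_dvd_iff dvd_field_iff)
  next
    case False
    then obtain z where z: "poly p z = 0"
      using fundamental_theorem_of_algebra[of p] by (auto simp: constant_degree)
    then obtain m where m: "p = [:- z, 1:] * m"
      by (auto simp: poly_eq_0_iff_dvd)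
    with less.prems have "m \<noteq> 0" "poly m 0 \<noteq> 0" "z \<noteq> 0"
      by auto
    moreover have "degree m < degree p"
      using m \<open>m \<noteq> 0\<close> by (simp add: degree_mult_eq del: mult_pCons_left)
    ultimately obtain f where f: "m dvd f\<^sup>2 - [:0, 1:]" "\<And>x. poly m x = 0 \<Longrightarrow> poly f x = csqrt x"
      using less.hyps by blast
    then obtain q where q: "f\<^sup>2 - [:0, 1:] = m * q"
      by (auto elim: dvdE)
    have qz: "poly f x ^ 2 - x = poly m x * poly q x" for x
      using arg_cong[OF q, of "\<lambda>p. poly p x"] by simp
    define c where "c = (if poly m z = 0 then - poly q z / (2 * csqrt z)
      else (csqrt z - poly f z) / poly m z)"
    define g where "g = f + smult c m"
    have g: "g\<^sup>2 - [:0, 1:] = m * (q + smult (2 * c) f + smult (c\<^sup>2) m)"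
    proof -
      have "poly (g\<^sup>2 - [:0, 1:]) x = poly (m * (q + smult (2 * c) f + smult (c\<^sup>2) m)) x" for x
        using qz[of x] by (simp add: g_def power2_eq_square algebra_simps)
      then show ?thesis
        by (metis poly_eqI poly_eq_poly_eq_iff ext)
    qed
    have gz: "poly g z = csqrt z"
      by (auto simp: g_def c_def f(2))
    \<comment> \<open>If \<open>z\<close> is a root of \<open>m\<close>, the claim is
      \<open>q(z) + 2 c csqrt z = 0\<close>, which \<open>c\<close> solves because \<open>z\<close>
      is nonzero. Otherwise \<open>g(z)^2 = z\<close>, and the nonzero factor \<open>m(z)\<close>
      cancels.\<close>
    have "poly (q + smult (2 * c) f + smult (c\<^sup>2) m) z = 0"
    proof (cases "poly m z = 0")
      case True
      then show ?thesis
        using \<open>z \<noteq> 0\<close> f(2)[OF True] by (simp add: c_def)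
    next
      case False
      moreover have "poly m z * poly (q + smult (2 * c) f + smult (c\<^sup>2) m) z = 0"
        using arg_cong[OF g, of "\<lambda>p. poly p z"] gz by simp
      ultimately show ?thesis
        by simp
    qed
    then have "[:- z, 1:] dvd q + smult (2 * c) f + smult (c\<^sup>2) m"
      by (simp only: poly_eq_0_iff_dvd)
    then have "p dvd g\<^sup>2 - [:0, 1:]"
      unfolding g m by (metis mult.commute mult_dvd_mono dvd_refl)
    moreover have "poly g x = csqrt x" if "poly p x = 0" for x
      using that gz f(2)[of x] by (auto simp: m g_def)
    ultimately show ?thesis
      by blast
  qed
qed

lemma Re_csqrt_pos:
  assumes "Re z > 0"
  shows "Re (csqrt z) > 0"
proof (rule ccontr)
  assume "\<not> Re (csqrt z) > 0"
  then have "Re (csqrt z) = 0"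
    using Re_csqrt[of z] by simp
  then have "Re ((csqrt z)\<^sup>2) \<le> 0"
    by (simp add: power2_eq_square)
  with assms show False
    by simp
qed

text \<open>The root is a polynomial \<open>f\<close> in \<open>S\<close>: \<open>f^2\<close> is
  congruent to the identity polynomial modulo an annihilator of \<open>S\<close>, and
  \<open>f\<close> agrees with \<open>csqrt\<close> on the spectrum, which places the eigenvalues of
  \<open>f(S)\<close> in the half plane.\<close>

lemma is_principal_sqrt_principal_sqrt:
  fixes S :: "complex ^ 'n ^ 'n"
  assumes "eigenvalues S \<subseteq> right_half_plane"
  shows "is_principal_sqrt S (principal_sqrt S)"
proof -
  obtain p where p: "p \<noteq> 0" "matrix_poly S p = 0" "{z. poly p z = 0} = eigenvalues S"
    by (rule ex_minimal_poly)
  have "poly p 0 \<noteq> 0"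
    using p(3) assms by (auto simp: right_half_plane_def)
  with p(1) obtain f where f: "p dvd f\<^sup>2 - [:0, 1:]" "\<And>z. poly p z = 0 \<Longrightarrow> poly f z = csqrt z"
    using ex_poly_sqrt_mod by blast
  then have "matrix_poly S (f\<^sup>2 - [:0, 1:]) = 0"
    using p(2) by (auto simp: matrix_poly_mult elim!: dvdE)
  then have square: "matrix_poly S f ** matrix_poly S f = S"
    by (simp add: matrix_poly_diff power2_eq_square matrix_poly_mult)
  have "\<mu> \<in> right_half_plane" if \<mu>: "\<mu> \<in> eigenvalues (matrix_poly S f)" for \<mu>
  proof -
    obtain w where w: "w \<noteq> 0" "matrix_poly S f *v w = \<mu> *s w"
      using \<mu> by (auto simp: eigenvalues_def)
    \<comment> \<open>A spectral mapping statement. If \<open>f\<close> is the constant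
      \<open>\<mu>\<close>, the difference is the zero polynomial and any eigenvalue of
      \<open>S\<close> will do; \<open>p\<close> supplies one.\<close>
    have "\<exists>z\<in>eigenvalues S. poly (f - [:\<mu>:]) z = 0"
    proof (cases "f - [:\<mu>:] = 0")
      case True
      have "matrix_poly S p *v w = 0"
        using p(2) by simp
      then show ?thesis
        using eigenvalue_if_poly_kills_vector w(1) p(1) True by force
    next
      case False
      have "matrix_poly S (f - [:\<mu>:]) *v w = 0"
        using w(2) by (simp add: matrix_poly_diff matrix_vector_mult_diff_rdistrib mat_vector_mul)
      then show ?thesis
        using eigenvalue_if_poly_kills_vector w(1) False by blast
    qed
    then obtain z where z: "z \<in> eigenvalues S" "poly f z = \<mu>"
      by auto
    then have "\<mu> = csqrt z"
      using f(2) p(3) by auto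
    then show ?thesis
      using z(1) assms Re_csqrt_pos by (auto simp: right_half_plane_def)
  qed
  with square have "is_principal_sqrt S (matrix_poly S f)"
    by (auto simp: is_principal_sqrt_def)
  then show ?thesis
    unfolding principal_sqrt_def
    by (rule theI) (erule is_principal_sqrt_unique, fact)
qed

subsection \<open>Induced norms\<close>

locale vector_norm =
  fixes N :: "complex ^ 'n \<Rightarrow> real"
  assumes vector_norm: "is_vector_norm N"
begin

abbreviation M :: "complex ^ 'n ^ 'n \<Rightarrow> real" where
  "M \<equiv> induced_norm N"

lemma
  shows N_nonneg [simp]: "0 \<le> N x"
    and N_eq_0_iff [simp]: "N x = 0 \<longleftrightarrow> x = 0"
    and N_scale: "N (c *s x) = cmod c * N x"
    and N_triangle: "N (x + y) \<le> N x + N y"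
  using vector_norm by (auto simp: is_vector_norm_def)

lemma N_0 [simp]: "N 0 = 0"
  by simp

lemma N_pos_iff [simp]: "0 < N x \<longleftrightarrow> x \<noteq> 0"
  by (metis N_eq_0_iff N_nonneg order_less_le)

lemma N_minus: "N (- x) = N x"
  using N_scale[of "- 1" x] by simp

lemma N_sum: "N (\<Sum>i\<in>I. f i) \<le> (\<Sum>i\<in>I. N (f i))"
proof (induction I rule: infinite_finite_induct)
  case (insert i I)
  then show ?case
    using N_triangle[of "f i" "\<Sum>i\<in>I. f i"] by simp
qed simp_all

lemma N_diff_le: "\<bar>N x - N y\<bar> \<le> N (x - y)"
  using N_triangle[of "x - y" y] N_triangle[of "y - x" x] N_minus[of "x - y"] by simp

lemma N_upper: "\<exists>K\<ge>0. \<forall>x. N x \<le> K * norm x"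
proof -
  define K where "K = (\<Sum>i\<in>UNIV. N (axis i 1))"
  have "0 \<le> K"
    by (simp add: K_def sum_nonneg)
  moreover have "N x \<le> K * norm x" for x
  proof -
    have "N x = N (\<Sum>i\<in>UNIV. x $ i *s axis i 1)"
      by (simp add: basis_expansion)
    also have "\<dots> \<le> (\<Sum>i\<in>UNIV. cmod (x $ i) * N (axis i 1))"
      using N_sum[of "\<lambda>i. x $ i *s axis i 1" UNIV] by (simp add: N_scale)
    also have "\<dots> \<le> (\<Sum>i\<in>UNIV. norm x * N (axis i 1))"
      by (intro sum_mono mult_right_mono) (auto intro: Finite_Cartesian_Product.norm_nth_le)
    finally show ?thesis
      by (simp add: K_def sum_distrib_left mult.commute)
  qed
  ultimately show ?thesis
    by blast
qed

text \<open>\<open>N\<close> is Lipschitz by the upper bound, so it attains a minimum on the compact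
  unit sphere; that minimum is positive and serves as \<open>c\<close>.\<close>

lemma N_lower: "\<exists>c>0. \<forall>x. c * norm x \<le> N x"
proof -
  obtain K where K: "0 \<le> K" "\<And>x. N x \<le> K * norm x"
    using N_upper by blast
  have "K-lipschitz_on UNIV N"
    using K N_diff_le by (intro lipschitz_onI) (auto simp: dist_norm intro: order_trans)
  then have "continuous_on (sphere 0 1) N"
    using lipschitz_on_continuous_on continuous_on_subset by blast
  moreover have "axis undefined 1 \<in> (sphere 0 1 :: (complex ^ 'n) set)"
    by (simp add: norm_vec_def L2_set_def axis_def if_distrib[of norm] if_distrib[of "\<lambda>x. x\<^sup>2"] cong: if_cong)
  ultimately obtain u where u: "u \<in> sphere 0 1" "\<And>x. x \<in> sphere 0 1 \<Longrightarrow> N u \<le> N x"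
    using continuous_attains_inf[of "sphere 0 1" N] by auto
  have "N u * norm x \<le> N x" for x
  proof (cases "x = 0")
    case False
    have "N u \<le> N (complex_of_real (inverse (norm x)) *s x)"
    proof (rule u(2))
      have "complex_of_real (inverse (norm x)) *s x = inverse (norm x) *\<^sub>R x"
        by (simp add: vec_eq_iff scaleR_conv_of_real[where 'a = complex])
      with False show "complex_of_real (inverse (norm x)) *s x \<in> sphere 0 1"
        by simp
    qed
    also have "\<dots> = inverse (norm x) * N x"
      unfolding N_scale norm_of_real by simp
    finally show ?thesis
      using False by (simp add: field_simps)
  qed simp
  moreover have "0 < N u"
    using u(1) by auto
  ultimately show ?thesis
    by blast
qed

text \<open>The supremum in \<open>induced_norm\<close> is informative only for a set bounded above;
  equivalence of \<open>N\<close> with the Euclidean norm gives the bound.\<close>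

lemma N_mul_le: "N (A *v x) \<le> M A * N x"
proof (cases "x = 0")
  case False
  obtain K where K: "0 \<le> K" "\<And>x. N x \<le> K * norm x"
    using N_upper by blast
  obtain c where c: "0 < c" "\<And>x. c * norm x \<le> N x"
    using N_lower by blast
  obtain B where B: "0 < B" "\<And>x. norm (A *v x) \<le> B * norm x"
    using linear_bounded_pos[OF matrix_vector_mul_linear] by blast
  have "N (A *v y) / N y \<le> K * (B / c)" if "y \<noteq> 0" for y
  proof -
    have "N (A *v y) \<le> K * (B * norm y)"
      using K B(2)[of y] by (meson mult_left_mono order_trans)
    also have "\<dots> \<le> K * (B * (N y / c))"
      using c K(1) B(1) by (intro mult_left_mono) (auto simp: field_simps)
    finally show ?thesis
      using that by (simp add: divide_le_eq)
  qed
  then have "bdd_above ((\<lambda>x. N (A *v x) / N x) ` {x. x \<noteq> 0})"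
    by (auto intro!: bdd_aboveI)
  then have "N (A *v x) / N x \<le> M A"
    unfolding induced_norm_def using False by (intro cSUP_upper) auto
  then show ?thesis
    using False by (simp add: divide_le_eq)
qed simp

lemma M_leI:
  assumes "\<And>x. N (A *v x) \<le> k * N x"
  shows "M A \<le> k"
proof -
  have "axis undefined 1 \<in> {x :: complex ^ 'n. x \<noteq> 0}"
    by simp
  then show ?thesis
    unfolding induced_norm_def using assms by (intro cSUP_least) (auto simp: divide_le_eq)
qed

lemma M_nonneg [simp]: "0 \<le> M A"
proof -
  have "0 \<le> M A * N (axis undefined 1)"
    using N_mul_le N_nonneg order_trans by blast
  moreover have "0 < N (axis undefined 1)"
    by simp
  ultimately show ?thesis
    by (simp only: zero_le_mult_iff) linarith
qed

lemma M_diff: "M (A - B) \<le> M A + M B"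
proof (rule M_leI)
  show "N ((A - B) *v x) \<le> (M A + M B) * N x" for x
    using N_triangle[of "A *v x" "- (B *v x)"] N_mul_le[of A x] N_mul_le[of B x]
    by (simp add: matrix_vector_mult_diff_rdistrib distrib_right N_minus)
qed

lemma M_mul: "M (A ** B) \<le> M A * M B"
proof (rule M_leI)
  fix x
  have "N (A *v (B *v x)) \<le> M A * (M B * N x)"
    using N_mul_le[of A "B *v x"] N_mul_le[of B x] by (meson M_nonneg mult_left_mono order_trans)
  then show "N ((A ** B) *v x) \<le> M A * M B * N x"
    by (simp add: matrix_vector_mul_assoc mult.assoc)
qed

lemma M_mul3: "M (A ** B ** C) \<le> M A * M B * M C"
  using M_mul[of "A ** B" C] M_mul[of A B] by (meson M_nonneg mult_right_mono order_trans)

lemma M_mat: "M (mat c) \<le> cmod c"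
  by (rule M_leI) (simp add: mat_vector_mul N_scale)

text \<open>Transfers convergence from \<open>M\<close> to the topology of the matrix type, entry by
  entry: the entry \<open>(i, j)\<close> is a coordinate of \<open>A k\<close> applied to a basis
  vector.\<close>

lemma tendsto_0_if_M_tendsto_0:
  assumes "(\<lambda>k. M (A k)) \<longlonglongrightarrow> 0"
  shows "A \<longlonglongrightarrow> 0"
proof -
  obtain c where c: "0 < c" "\<And>x. c * norm x \<le> N x"
    using N_lower by blast
  have "(\<lambda>k. A k $ i $ j) \<longlonglongrightarrow> 0" for i j
  proof (rule Lim_null_comparison)
    show "\<forall>\<^sub>F k in sequentially. norm (A k $ i $ j) \<le> M (A k) * N (axis j 1) / c"
    proof (rule always_eventually, rule allI)
      fix k
      have "A k $ i $ j = (A k *v axis j 1) $ i"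
        by (simp add: matrix_vector_mult_def axis_def if_distrib[of "\<lambda>x. _ * x"] cong: if_cong)
      then have "norm (A k $ i $ j) \<le> norm (A k *v axis j 1)"
        by (metis Finite_Cartesian_Product.norm_nth_le)
      then have "c * norm (A k $ i $ j) \<le> c * norm (A k *v axis j 1)"
        using c(1) by simp
      also have "\<dots> \<le> M (A k) * N (axis j 1)"
        using c(2) N_mul_le order_trans by blast
      finally show "norm (A k $ i $ j) \<le> M (A k) * N (axis j 1) / c"
        using c(1) by (simp add: field_simps)
    qed
    show "(\<lambda>k. M (A k) * N (axis j 1) / c) \<longlonglongrightarrow> 0"
      using tendsto_mult_right[OF assms, of "N (axis j 1) / c"] by simp
  qed
  then show ?thesis
    by (auto intro!: vec_tendstoI)
qed

text \<open>No series is summed: the estimate \<open>(1 - e) N x <= N ((1 - E) x)\<close> forces a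
  trivial kernel and, applied to a preimage of \<open>x\<close>, bounds the inverse.\<close>

lemma M_neumann:
  assumes "M E \<le> e" "e < 1"
  shows "invertible (mat 1 - E)" "M (matrix_inv (mat 1 - E)) \<le> 1 / (1 - e)"
proof -
  have lower: "(1 - e) * N x \<le> N ((mat 1 - E) *v x)" for x
  proof -
    have "N x - N (E *v x) \<le> N ((mat 1 - E) *v x)"
      using N_diff_le[of x "E *v x"] by (simp add: matrix_vector_mult_diff_rdistrib)
    moreover have "N (E *v x) \<le> e * N x"
      using N_mul_le[of E x] assms(1) by (meson N_nonneg mult_right_mono order_trans)
    ultimately show ?thesis
      by (simp add: algebra_simps)
  qed
  show inv: "invertible (mat 1 - E)"
  proof (rule invertible_if_ker_trivial)
    fix v
    assume v: "(mat 1 - E) *v v = 0"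
    have "(1 - e) * N v \<le> 0"
      using lower[of v] unfolding v by simp
    with assms(2) have "N v \<le> 0"
      by (simp add: mult_le_0_iff)
    then show "v = 0"
      using N_pos_iff[of v] by linarith
  qed
  show "M (matrix_inv (mat 1 - E)) \<le> 1 / (1 - e)"
  proof (rule M_leI)
    fix x
    have "(1 - e) * N (matrix_inv (mat 1 - E) *v x) \<le> N x"
      using lower[of "matrix_inv (mat 1 - E) *v x"] matrix_inv_mul(1)[OF inv]
      by (simp add: matrix_vector_mul_assoc)
    then show "N (matrix_inv (mat 1 - E) *v x) \<le> 1 / (1 - e) * N x"
      using assms(2) by (simp add: field_simps)
  qed
qed

end

subsection \<open>The iteration in Cayley coordinates\<close>

locale cayley_contraction = vector_norm N for N :: "complex ^ 'n \<Rightarrow> real" +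
  fixes R C :: "complex ^ 'n ^ 'n"
  assumes commute: "C ** R = R ** C"
    and invertible_R: "invertible R"
    and contraction: "M C < 1"
begin

abbreviation F :: "complex poly \<Rightarrow> complex ^ 'n ^ 'n" where
  "F \<equiv> matrix_poly C"

text \<open>
  The matrix whose Cayley transform is the \<^term>\<open>i\<close>-th power of \<^term>\<open>C\<close>; the polynomials keep
  the algebra of powers of \<^term>\<open>C\<close> in a commutative ring.
\<close>

definition T :: "nat \<Rightarrow> complex ^ 'n ^ 'n" where
  "T i = F (1 + monom 1 i) ** matrix_inv (F (1 - monom 1 i)) ** R"

lemma F_R_commute: "F p ** R = R ** F p"
  by (rule matrix_poly_intertwine[OF commute])

text \<open>Rewrite rules moving \<open>R\<close> to the right of all polynomials in
  \<open>C\<close>; the second form reaches inside left-nested products.\<close>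

lemma R_F_normalize: "R ** F p = F p ** R" "A ** R ** F p = A ** F p ** R"
  by (simp_all only: F_R_commute flip: matrix_mul_assoc)

lemma M_F_monom: "M (F (monom 1 i)) \<le> M C ^ i"
proof (induction i)
  case 0
  show ?case
    using M_mat[of 1] by simp
next
  case (Suc i)
  have "M (F (monom 1 (Suc i))) \<le> M C * M (F (monom 1 i))"
    by (simp add: monom_Suc M_mul)
  also have "\<dots> \<le> M C * M C ^ i"
    using Suc by (simp add: mult_left_mono)
  finally show ?case
    by simp
qed

text \<open>The source of the order \<open>r\<close>. The bound is by the norm of \<open>C^i\<close>
  rather than by \<open>M C\<close>, so that it can be compared with the error at
  \<open>T i\<close>.\<close>

lemma M_F_monom_mult: "M (F (monom 1 (i * r))) \<le> M (F (monom 1 i)) ^ r"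
proof (induction r)
  case 0
  show ?case
    using M_mat[of 1] by simp
next
  case (Suc r)
  have "monom 1 (i * Suc r) = monom 1 i * monom (1 :: complex) (i * r)"
    by (simp add: mult_monom)
  then have "M (F (monom 1 (i * Suc r))) \<le> M (F (monom 1 i)) * M (F (monom 1 (i * r)))"
    by (simp only: matrix_poly_mult M_mul)
  also have "\<dots> \<le> M (F (monom 1 i)) * M (F (monom 1 i)) ^ r"
    using Suc by (simp add: mult_left_mono)
  finally show ?case
    by simp
qed

lemma M_C_power_le:
  assumes "1 \<le> i"
  shows "M C ^ i \<le> M C"
  using power_decreasing[of 1 i "M C"] assms contraction by simp

lemma F_denominator: "F (1 - monom 1 i) = mat 1 - F (monom 1 i)"
  by (simp add: matrix_poly_diff)

lemma
  assumes "1 \<le> i"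
  shows invertible_denominator: "invertible (F (1 - monom 1 i))"
    and M_inv_denominator: "M (matrix_inv (F (1 - monom 1 i))) \<le> 1 / (1 - M C)"
  unfolding F_denominator
  using M_neumann[of "F (monom 1 i)" "M C"] M_F_monom[of i] M_C_power_le[OF assms] contraction
  by auto

lemma T_denominator:
  assumes "1 \<le> i"
  shows "T i ** F (1 - monom 1 i) = F (1 + monom 1 i) ** R"
proof -
  let ?D = "F (1 - monom 1 i)"
  have "T i ** ?D = F (1 + monom 1 i) ** (matrix_inv ?D ** ?D) ** R"
    by (simp only: T_def matrix_mul_assoc R_F_normalize)
  also have "matrix_inv ?D ** ?D = mat 1"
    using invertible_denominator[OF assms] by (rule matrix_inv_mul)
  finally show ?thesis
    by simp
qed

text \<open>With \<open>s = C^i\<close> and \<open>t = C^j\<close> this is the addition formula of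
  the hyperbolic cotangent. It rests on \<open>(1+s)(1-t) + (1+t)(1-s) = 2(1-st)\<close> and
  \<open>(1-s)(1-t) + (1+s)(1+t) = 2(1+st)\<close>, read after multiplication by both
  denominators.\<close>

lemma T_step:
  assumes "1 \<le> i" "1 \<le> j"
  shows "(R ** R + T i ** T j) ** matrix_inv (T i + T j) = T (i + j)"
proof -
  define a b c where "a = 1 + monom (1 :: complex) i" and "b = 1 + monom (1 :: complex) j"
    and "c = 1 + monom (1 :: complex) (i + j)"
  define d e f where "d = 1 - monom (1 :: complex) i" and "e = 1 - monom (1 :: complex) j"
    and "f = 1 - monom (1 :: complex) (i + j)"
  have monom: "monom 1 (i + j) = monom 1 i * monom (1 :: complex) j"
    by (simp add: mult_monom)
  have ad: "a * e + b * d = f * [:2:]" and de: "d * e + a * b = c * [:2:]"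
    by (simp_all add: a_def b_def c_def d_def e_def f_def monom algebra_simps flip: numeral_poly)
  have Ti: "T i ** F d = F a ** R" and Tj: "T j ** F e = F b ** R"
    and Tij: "T (i + j) ** F f = F c ** R"
    using T_denominator assms by (simp_all add: a_def b_def c_def d_def e_def f_def)
  have inv_d: "invertible (F d)" and inv_e: "invertible (F e)" and inv_f: "invertible (F f)"
    using invertible_denominator assms by (simp_all add: d_def e_def f_def)
  \<comment> \<open>The denominators are swapped to bring \<open>F e\<close> next to
    \<open>T j\<close>, whose denominator it clears.\<close>
  have "T j ** F d ** F e = T j ** (F e ** F d)"
    unfolding matrix_poly_commute[of C e d] by (simp only: matrix_mul_assoc)
  then have Tj': "T j ** F d ** F e = F b ** R ** F d"
    by (simp only: matrix_mul_assoc Tj)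
  have "(T i + T j) ** F (d * e) = F a ** R ** F e + F b ** R ** F d"
    by (simp only: matrix_poly_mult matrix_mul_rdistrib matrix_mul_assoc Ti Tj')
  also have "\<dots> = F (a * e + b * d) ** R"
    by (simp only: matrix_poly_mult matrix_poly_add matrix_mul_rdistrib R_F_normalize)
  finally have sum: "(T i + T j) ** F (d * e) = F f ** F [:2:] ** R"
    by (simp only: ad matrix_poly_mult)
  have "invertible (mat 2 :: complex ^ 'n ^ 'n)"
    unfolding invertible_right_inverse by (rule exI[of _ "mat (1 / 2)"]) (simp add: mat_mul_mat)
  \<comment> \<open>Invertibility of \<open>T i + T j\<close> is read off from the cleared form: a
    left factor of an invertible square matrix product is invertible.\<close>
  then have "invertible (F f ** F [:2:] ** R)"
    using inv_f invertible_R by (intro invertible_mult) simp_all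
  then have inv_sum: "invertible (T i + T j)"
    unfolding sum[symmetric] by (rule invertible_if_mul_invertible)
  have "(R ** R + T i ** T j) ** F (d * e) = R ** R ** F (d * e) + T i ** (T j ** F d ** F e)"
    by (simp only: matrix_poly_mult matrix_mul_rdistrib matrix_mul_assoc)
  also have "T i ** (T j ** F d ** F e) = T i ** (F b ** F d) ** R"
    by (simp only: Tj' matrix_mul_assoc R_F_normalize)
  also have "\<dots> = F (a * b) ** R ** R"
    unfolding matrix_poly_commute[of C b d]
    by (simp only: matrix_poly_mult matrix_mul_assoc Ti R_F_normalize)
  also have "R ** R ** F (d * e) = F (d * e) ** R ** R"
    by (simp only: R_F_normalize)
  also have "F (d * e) ** R ** R + F (a * b) ** R ** R = F (d * e + a * b) ** R ** R"
    by (simp only: matrix_poly_add matrix_mul_rdistrib)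
  also have "\<dots> = T (i + j) ** F f ** F [:2:] ** R"
    by (simp only: de matrix_poly_mult Tij R_F_normalize)
  also have "\<dots> = T (i + j) ** (T i + T j) ** F (d * e)"
    by (simp only: sum flip: matrix_mul_assoc)
  finally have "(R ** R + T i ** T j) ** F (d * e) = T (i + j) ** (T i + T j) ** F (d * e)" .
  moreover have "invertible (F (d * e))"
    unfolding matrix_poly_mult by (intro invertible_mult inv_d inv_e)
  ultimately have "R ** R + T i ** T j = T (i + j) ** (T i + T j)"
    using invertible_matrix_mul_cancel_right by blast
  then show ?thesis
    using matrix_eq_mul_inv[OF inv_sum, of "T (i + j)"] by simp
qed

lemma T_minus_R_denominator:
  assumes "1 \<le> i"
  shows "(T i - R) ** F (1 - monom 1 i) = F (monom 1 i) ** F [:2:] ** R"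
proof -
  have "(T i - R) ** F (1 - monom 1 i) = F ((1 + monom 1 i) - (1 - monom 1 i)) ** R"
    unfolding matrix_poly_diff[of _ "1 + monom 1 i"]
    by (simp only: matrix_mul_diff_rdistrib T_denominator[OF assms] F_R_commute)
  also have "(1 + monom 1 i) - (1 - monom 1 i) = monom 1 i * ([:2:] :: complex poly)"
    by (simp flip: numeral_poly)
  finally show ?thesis
    by (simp only: matrix_poly_mult)
qed

lemma M_T_minus_R:
  assumes "1 \<le> i"
  shows "M (T i - R) \<le> M (F (monom 1 i)) * (2 * M R / (1 - M C))"
proof -
  let ?J = "matrix_inv (F (1 - monom 1 i))"
  have "T i - R = F (monom 1 i) ** F [:2:] ** R ** ?J"
    using T_minus_R_denominator invertible_denominator assms by (intro matrix_eq_mul_inv)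
  then have "M (T i - R) \<le> M (F (monom 1 i) ** F [:2:] ** R) * M ?J"
    by (simp only: M_mul)
  also have "\<dots> \<le> (M (F (monom 1 i)) * M (F [:2:]) * M R) * (1 / (1 - M C))"
    using M_mul3 M_inv_denominator[OF assms] by (intro mult_mono) auto
  also have "\<dots> \<le> (M (F (monom 1 i)) * 2 * M R) * (1 / (1 - M C))"
    using M_mat[of 2] contraction by (intro mult_right_mono mult_left_mono) auto
  finally show ?thesis
    by (simp add: mult.assoc)
qed

text \<open>Converse of the preceding estimate. Solving for \<open>C^i\<close> leaves the factor
  \<open>(1 - C^i) / 2\<close>, whose norm is at most 1 since \<open>C^i\<close> has norm at most
  1.\<close>

lemma M_F_monom_le:
  assumes "1 \<le> i"
  shows "M (F (monom 1 i)) \<le> M (T i - R) * M (matrix_inv R)"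
proof -
  have "(T i - R) ** F ((1 - monom 1 i) * [:1 / 2:]) = F (monom 1 i) ** F [:2:] ** R ** F [:1 / 2:]"
    unfolding matrix_poly_mult matrix_mul_assoc T_minus_R_denominator[OF assms] ..
  also have "\<dots> = F (monom 1 i) ** (F [:2:] ** F [:1 / 2:]) ** R"
    by (simp only: matrix_mul_assoc R_F_normalize)
  also have "F [:2:] ** F [:1 / 2:] = mat 1"
    by (simp add: mat_mul_mat)
  finally have eq: "F (monom 1 i) = (T i - R) ** F ((1 - monom 1 i) * [:1 / 2:]) ** matrix_inv R"
    using invertible_R by (intro matrix_eq_mul_inv) simp_all
  have "M (F (1 - monom 1 i)) \<le> M (mat 1) + M (F (monom 1 i))"
    unfolding F_denominator by (rule M_diff)
  also have "\<dots> \<le> 1 + 1"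
    using M_mat[of 1] M_F_monom[of i] M_C_power_le[OF assms] contraction by (intro add_mono) auto
  finally have "M (F (1 - monom 1 i)) * M (F [:1 / 2:]) \<le> 2 * (1 / 2)"
    using M_mat[of "1 / 2"] by (intro mult_mono) auto
  then have "M (F ((1 - monom 1 i) * [:1 / 2:])) \<le> 1"
    unfolding matrix_poly_mult using M_mul order_trans by fastforce
  then have "M (T i - R) * M (F ((1 - monom 1 i) * [:1 / 2:])) * M (matrix_inv R)
      \<le> M (T i - R) * 1 * M (matrix_inv R)"
    by (intro mult_left_mono mult_right_mono) auto
  then show ?thesis
    using M_mul3[of "T i - R" "F ((1 - monom 1 i) * [:1 / 2:])" "matrix_inv R"]
    unfolding eq[symmetric] by simp
qed

section \<open>Order of convergence, the limit, and the identification of the iterates\<close>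

text \<open>Error at \<open>T (i * r)\<close> is at most a constant times the norm of
  \<open>C^(ir)\<close>, hence of the \<open>r\<close>-th power of the norm of \<open>C^i\<close>,
  which the error at \<open>T i\<close> controls up to the norm of the inverse of
  \<open>R\<close>.\<close>

lemma M_T_order:
  assumes "1 \<le> i" "1 \<le> r"
  shows "M (T (i * r) - R) \<le> M (matrix_inv R) ^ r * (2 * M R / (1 - M C)) * M (T i - R) ^ r"
proof -
  have K: "0 \<le> 2 * M R / (1 - M C)"
    using contraction by simp
  have "M (T (i * r) - R) \<le> M (F (monom 1 (i * r))) * (2 * M R / (1 - M C))"
    using assms by (intro M_T_minus_R) simp
  also have "\<dots> \<le> (M (T i - R) * M (matrix_inv R)) ^ r * (2 * M R / (1 - M C))"
    using M_F_monom_mult[of i r] power_mono[OF M_F_monom_le[OF assms(1)], of r] K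
    by (intro mult_right_mono) auto
  finally show ?thesis
    by (simp add: power_mult_distrib mult_ac)
qed

lemma T_tendsto_R: "T \<longlonglongrightarrow> R"
proof -
  have "(\<lambda>i. M (T i - R)) \<longlonglongrightarrow> 0"
  proof (rule Lim_null_comparison)
    have "norm (M (T i - R)) \<le> M C ^ i * (2 * M R / (1 - M C))" if "1 \<le> i" for i
    proof -
      have "M (F (monom 1 i)) * (2 * M R / (1 - M C)) \<le> M C ^ i * (2 * M R / (1 - M C))"
        using M_F_monom contraction by (intro mult_right_mono) auto
      then show ?thesis
        using M_T_minus_R[OF that] by simp
    qed
    then show "\<forall>\<^sub>F i in sequentially. norm (M (T i - R)) \<le> M C ^ i * (2 * M R / (1 - M C))"
      by (auto simp: eventually_sequentially)
    have "(\<lambda>i. M C ^ i) \<longlonglongrightarrow> 0"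
      using contraction by (intro LIMSEQ_power_zero) simp
    then show "(\<lambda>i. M C ^ i * (2 * M R / (1 - M C))) \<longlonglongrightarrow> 0"
      by (rule tendsto_mult_left_zero)
  qed
  then show ?thesis
    by (intro LIM_zero_cancel[of T R] tendsto_0_if_M_tendsto_0)
qed

text \<open>Exponents add at each update: within an outer step starting from exponent
  \<open>m\<close>, the inner iterate \<open>l\<close> has exponent \<open>l * m\<close>, and the
  final update reaches \<open>(r - 1) * m + m = r * m\<close>.\<close>

lemma iteration_eq_T:
  assumes "order_sqrt_iteration (R ** R) \<gamma> r Q" "mat (complex_of_real \<gamma>) = T 1" "1 < r"
  shows "Q (Suc k) = T (r ^ k)"
proof -
  obtain Y where Y: "\<forall>k\<ge>2. Y (k - 1) 1 = Q (k - 1) \<and>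
      (\<forall>l\<in>{1..r - 2}. Y (k - 1) (l + 1) =
        (R ** R + Q (k - 1) ** Y (k - 1) l) ** matrix_inv (Q (k - 1) + Y (k - 1) l)) \<and>
      Q k = (R ** R + Q (k - 1) ** Y (k - 1) (r - 1)) ** matrix_inv (Q (k - 1) + Y (k - 1) (r - 1))"
    using assms(1) unfolding order_sqrt_iteration_def by blast
  have Q1: "Q 1 = T 1"
    using assms(1,2) unfolding order_sqrt_iteration_def by simp
  have Y_1: "Y (Suc k) 1 = Q (Suc k)" for k
    using Y[rule_format, of "Suc (Suc k)"] by simp
  have Y_Suc: "Y (Suc k) (Suc l) = (R ** R + Q (Suc k) ** Y (Suc k) l) ** matrix_inv (Q (Suc k) + Y (Suc k) l)"
    if "1 \<le> l" "l \<le> r - 2" for k l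
    using Y[rule_format, of "Suc (Suc k)"] that by simp
  have Q_Suc: "Q (Suc (Suc k)) =
      (R ** R + Q (Suc k) ** Y (Suc k) (r - 1)) ** matrix_inv (Q (Suc k) + Y (Suc k) (r - 1))" for k
    using Y[rule_format, of "Suc (Suc k)"] by simp
  show ?thesis
  proof (induction k)
    case 0
    show ?case
      using Q1 by simp
  next
    case (Suc k)
    define m where "m = r ^ k"
    have m: "1 \<le> m"
      using assms(3) by (simp add: m_def)
    have inner: "Y (Suc k) (Suc l) = T (Suc l * m)" if "Suc l \<le> r - 1" for l
      using that
    proof (induction l)
      case 0
      show ?case
        using Y_1[of k] \<open>Q (Suc k) = T (r ^ k)\<close> by (simp add: m_def)
    next
      case (Suc l)
      then have "Y (Suc k) (Suc (Suc l)) =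
          (R ** R + T m ** T (Suc l * m)) ** matrix_inv (T m + T (Suc l * m))"
        using Y_Suc[of "Suc l" k] \<open>Q (Suc k) = T (r ^ k)\<close> by (simp add: m_def)
      also have "\<dots> = T (m + Suc l * m)"
        using m by (intro T_step) auto
      finally show ?case
        by simp
    qed
    \<comment> \<open>Makes \<open>r - 1\<close> equal to \<open>Suc l\<close>, the index form of
      \<open>inner\<close>; for \<open>r = 2\<close> it is the starting inner iterate.\<close>
    obtain l where l: "r = Suc (Suc l)"
      using assms(3) less_imp_Suc_add[of 1 r] by auto
    have "Q (Suc (Suc k)) = (R ** R + T m ** T (Suc l * m)) ** matrix_inv (T m + T (Suc l * m))"
      using Q_Suc[of k] inner[of l] Suc.IH by (simp add: m_def l)
    also have "\<dots> = T (m + Suc l * m)"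
      using m by (intro T_step) auto
    finally show ?case
      by (simp add: m_def l)
  qed
qed

end

theorem theorem4p2:
  fixes S :: "complex ^ 'n ^ 'n"
    and \<gamma> :: real
    and r :: nat
    and Q :: "nat \<Rightarrow> complex ^ 'n ^ 'n"
    and M :: "complex ^ 'n ^ 'n \<Rightarrow> real"
  assumes "invertible S"
    and "eigenvalues S \<subseteq> right_half_plane"
    and "0 < \<gamma>"
    and "1 < r"
    and "order_sqrt_iteration S \<gamma> r Q"
    and "is_induced_matrix_norm M"
    and "M (cayley (principal_sqrt S) (Q 1)) < 1"
  shows "(\<exists>\<mu>>0. \<forall>k\<ge>1. M (Q (k + 1) - principal_sqrt S) \<le> \<mu> * M (Q k - principal_sqrt S) ^ r)
    \<and> converges_with_q_order M r Q (principal_sqrt S)"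
proof -
  define R where "R = principal_sqrt S"
  define G :: "complex ^ 'n ^ 'n" where "G = mat (complex_of_real \<gamma>)"
  define C where "C = (G - R) ** matrix_inv (G + R)"
  obtain N where N: "is_vector_norm N" "M = induced_norm N"
    using assms(6) by (auto simp: is_induced_matrix_norm_def)
  have R: "R ** R = S" "eigenvalues R \<subseteq> right_half_plane"
    using is_principal_sqrt_principal_sqrt[OF assms(2)] by (auto simp: R_def is_principal_sqrt_def)
  have Q1: "Q 1 = G"
    using assms(5) by (simp add: order_sqrt_iteration_def G_def)
  have GR: "G ** R = R ** G"
    by (simp add: G_def mat_mul_commute)
  \<comment> \<open>A kernel vector would make \<open>-x\<close> an eigenvalue of \<open>R\<close>,
    outside the half plane. Used at \<open>\<gamma>\<close> for \<open>G + R\<close> and at 0 for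
    \<open>R\<close> itself.\<close>
  have inv: "invertible (mat (complex_of_real x) + R)" if "0 \<le> x" for x
  proof (rule invertible_if_ker_trivial, rule ccontr)
    fix v
    assume v: "(mat (complex_of_real x) + R) *v v = 0" "v \<noteq> 0"
    then have "complex_of_real x *s v + R *v v = 0"
      by (simp add: matrix_vector_mult_add_rdistrib mat_vector_mul)
    then have "R *v v = (- complex_of_real x) *s v"
      by (simp add: eq_neg_iff_add_eq_0 add.commute)
    with v(2) have "- complex_of_real x \<in> eigenvalues R"
      unfolding eigenvalues_def by blast
    with R(2) have "- complex_of_real x \<in> right_half_plane" ..
    with that show False
      by (simp add: right_half_plane_def)
  qed
  have inv_GR: "invertible (G + R)" and inv_R: "invertible R"
    using inv[of \<gamma>] inv[of 0] assms(3) by (auto simp: G_def)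
  let ?J = "matrix_inv (G + R)"
  have J: "?J ** R = R ** ?J"
    using inv_GR by (intro matrix_inv_commute) (simp_all add: matrix_mul_rdistrib matrix_add_ldistrib GR)
  have "C ** R = (G - R) ** R ** ?J"
    unfolding C_def matrix_mul_assoc[symmetric] J ..
  also have "(G - R) ** R = R ** (G - R)"
    by (simp add: matrix_mul_diff_rdistrib matrix_mul_diff_ldistrib GR)
  finally have CR: "C ** R = R ** C"
    by (simp only: C_def matrix_mul_assoc)
  have "M C < 1"
    using assms(7) unfolding cayley_def C_def Q1 R_def .
  then interpret cayley_contraction N R C
    unfolding N(2) using N(1) CR inv_R by unfold_locales
  have C_GR: "C ** (G + R) = G - R"
    unfolding C_def matrix_mul_assoc[symmetric] matrix_inv_mul(2)[OF inv_GR] by simp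
  \<comment> \<open>Inverts the Cayley transform to recognise \<open>G\<close> as
    \<open>T 1\<close>. Multiplied by \<open>G + R\<close>, both sides become
    \<open>2 G R\<close>.\<close>
  have "G ** (mat 1 - C) ** (G + R) = (mat 1 + C) ** R ** (G + R)"
  proof -
    have "R ** (G + R) = (G + R) ** R"
      by (simp add: matrix_mul_rdistrib matrix_add_ldistrib GR)
    then have "(mat 1 + C) ** R ** (G + R) = (mat 1 + C) ** (G + R) ** R"
      by (simp only: flip: matrix_mul_assoc)
    also have "(mat 1 + C) ** (G + R) = (G + R) + C ** (G + R)"
      by (simp only: matrix_mul_rdistrib matrix_mul_lid)
    also have "((G + R) + C ** (G + R)) ** R = ((G + R) + (G - R)) ** R"
      by (simp only: C_GR)
    also have "(G + R) + (G - R) = G + G"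
      by simp
    also have "(G + G) ** R = G ** (R + R)"
      by (simp only: matrix_mul_rdistrib matrix_add_ldistrib)
    also have "R + R = (G + R) - (G - R)"
      by simp
    also have "G ** ((G + R) - (G - R)) = G ** (mat 1 ** (G + R) - C ** (G + R))"
      by (simp only: C_GR matrix_mul_lid)
    also have "\<dots> = G ** (mat 1 - C) ** (G + R)"
      by (simp only: matrix_mul_diff_rdistrib flip: matrix_mul_assoc)
    finally show ?thesis ..
  qed
  then have "G ** (mat 1 - C) = (mat 1 + C) ** R"
    using inv_GR invertible_matrix_mul_cancel_right by blast
  then have "G ** F (1 - monom 1 1) = T 1 ** F (1 - monom 1 1)"
    using T_denominator[of 1] by (simp add: matrix_poly_add matrix_poly_diff monom_Suc)
  then have "G = T 1"
    using invertible_denominator[of 1] invertible_matrix_mul_cancel_right by blast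
  then have Q: "Q (Suc k) = T (r ^ k)" for k
    using iteration_eq_T[of \<gamma> r Q k] assms(4,5) R(1) by (simp add: G_def)
  \<comment> \<open>The constant of \<open>M_T_order\<close>; adding 1 turns its nonnegativity into
    positivity.\<close>
  define \<mu> where "\<mu> = induced_norm N (matrix_inv R) ^ r
    * (2 * induced_norm N R / (1 - induced_norm N C)) + 1"
  have "0 \<le> induced_norm N (matrix_inv R) ^ r * (2 * induced_norm N R / (1 - induced_norm N C))"
    using contraction by simp
  then have "0 < \<mu>"
    by (simp add: \<mu>_def)
  moreover have "M (Q (k + 1) - R) \<le> \<mu> * M (Q k - R) ^ r" if k1: "1 \<le> k" for k
  proof -
    obtain j where k: "k = Suc j"
      using k1 by (cases k) auto
    have "M (T (r ^ j * r) - R) \<le> (\<mu> - 1) * M (T (r ^ j) - R) ^ r"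
      using M_T_order[of "r ^ j" r] assms(4) by (simp add: N(2) \<mu>_def)
    also have "\<dots> \<le> \<mu> * M (T (r ^ j) - R) ^ r"
      by (intro mult_right_mono) (simp_all add: N(2))
    finally show ?thesis
      using Q[of j] Q[of k] by (simp add: k mult.commute)
  qed
  ultimately have order: "\<exists>\<mu>>0. \<forall>k\<ge>1. M (Q (k + 1) - R) \<le> \<mu> * M (Q k - R) ^ r"
    by blast
  \<comment> \<open>The outer iterates are the subsequence of \<open>T\<close> at the indices
    \<open>r ^ k\<close>.\<close>
  have "strict_mono (\<lambda>k. r ^ k)"
    using assms(4) by (intro strict_monoI) (rule power_strict_increasing)
  then have "(\<lambda>k. Q (Suc k)) \<longlonglongrightarrow> R"
    unfolding Q using LIMSEQ_subseq_LIMSEQ[OF T_tendsto_R] by (simp add: o_def)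
  then have "Q \<longlonglongrightarrow> R"
    by (rule LIMSEQ_imp_Suc)
  with order show ?thesis
    using assms(4) unfolding converges_with_q_order_def R_def by blast
qed

end
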